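(* Let $\ell$ be a prime with $\ell\equiv 3\pmod 4$, let $\mathbb{K}$ be a field of characteristic $\ell$ and let $P(t)\in\mathbb{K}[t]$ be an irreducible polynomial. Then the $P(t)$-adic Littlewood Conjecture fails over $\mathbb{K}$. More precisely, let $\Lambda(t)=\sum_{n=1}^{\infty}\lambda_n t^{-n}$, where $(\lambda_n)_{n\ge 0}$ is the paperfolding sequence over the alphabet $(1,-1)$, with its values seen in $\mathbb{K}$. Then the Laurent series $\Lambda(P(t))=\sum_{n=1}^{\infty}\lambda_n P(t)^{-n}\in\mathbb{K}((t^{-1}))$ is a counterexample to the $P(t)$-adic Littlewood Conjecture over $\mathbb{K}$ and, furthermore, $$\inf_{Q(t)\in\mathbb{K}[t]\setminus\{0\}} |Q(t)|\cdot |Q(t)|_{P(t)}\cdot \left|\left\langle Q(t)\cdot \Lambda(P(t))\right\rangle\right| = 2^{-4\cdot\deg P(t)}.$$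
   Context: The paperfolding sequence $(\lambda_n)_{n\ge 0}$ over the alphabet $(1,-1)$ is the sequence with values in $\{1,-1\}$ determined by $\lambda_{2k}=(-1)^k$ and $\lambda_{2k+1}=\lambda_k$ for all $k\ge 0$ (so it starts $1,1,-1,1,1,-1,-1,1,\dots$). $\mathbb{K}((t^{-1}))$ is the field of formal Laurent series in $t^{-1}$, i.e. of expansions $\Gamma(t)=\sum_{k\ge -n_0}\gamma_k t^{-k}$ with finitely many nonzero terms having a positive exponent of $t$. The norm is $|\Gamma(t)|=2^{\deg\Gamma(t)}$, where $\deg\Gamma(t)$ is the largest exponent of $t$ with nonzero coefficient, and $|0|=0$. The fractional part is $\langle\Gamma(t)\rangle=\sum_{k\ge 1}\gamma_k t^{-k}$. For nonzero $Q(t)\in\mathbb{K}[t]$, $|Q(t)|_{P(t)}=2^{-\nu\cdot\deg P(t)}$, where $\nu\ge 0$ is the largest integer such that $P(t)^{\nu}$ divides $Q(t)$. The $P(t)$-adic Littlewood Conjecture over $\mathbb{K}$ is the assertion that for every $\Gamma(t)\in\mathbb{K}((t^{-1}))$, $$\inf_{Q(t)\in\mathbb{K}[t]\setminus\{0\}}|Q(t)|\cdot|Q(t)|_{P(t)}\cdot|\langle Q(t)\cdot\Gamma(t)\rangle|=0.$$ A counterexample is a $\Gamma(t)$ for which this infimum is positive. *)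

theory Defs
  imports Complex_Main "HOL-Computational_Algebra.Computational_Algebra"
begin

function paperfolding :: "nat \<Rightarrow> int" where
  "paperfolding n = (if even n then (- 1) ^ (n div 2) else paperfolding (n div 2))"
  by auto
termination by (relation "measure id") (auto elim: oddE)

declare paperfolding.simps [simp del]

lemma paperfolding_even: "paperfolding (2 * k) = (- 1) ^ k"
  by (subst paperfolding.simps) simp

lemma paperfolding_odd: "paperfolding (2 * k + 1) = paperfolding k"
  by (subst paperfolding.simps) simp

text \<open>
  The field of formal Laurent series in \<open>1/t\<close> is the type \<open>'k fls\<close> with its formal variable
  read as \<open>1/t\<close>: the coefficient of \<open>t\<close> to the power \<open>-k\<close> in \<open>\<Gamma>\<close> is \<open>fls_nth \<Gamma> k\<close>, the element \<open>t\<close>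
  itself is \<open>fls_X_inv\<close>, and the degree in \<open>t\<close> of a nonzero \<open>\<Gamma>\<close> is \<open>- fls_subdegree \<Gamma>\<close>.
  The library metric on \<open>'k fls\<close> is the one induced by the norm below.
\<close>

definition laurent_of_poly :: "'k::field poly \<Rightarrow> 'k fls" where
  "laurent_of_poly Q = poly (map_poly fls_const Q) fls_X_inv"

definition laurent_norm :: "'k::field fls \<Rightarrow> real" where
  "laurent_norm \<Gamma> = (if \<Gamma> = 0 then 0 else 2 powi (- fls_subdegree \<Gamma>))"

lemma dist_fls_eq_laurent_norm: "dist \<Gamma> \<Delta> = laurent_norm (\<Gamma> - \<Delta>)"
  by (auto simp: dist_fls_def laurent_norm_def power_int_def power_one_over inverse_eq_divide)

definition laurent_frac :: "'k::field fls \<Rightarrow> 'k fls" where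
  "laurent_frac \<Gamma> = fps_to_fls (Abs_fps (\<lambda>k. if k = 0 then 0 else fls_nth \<Gamma> (int k)))"

text \<open>
  The greatest exponent exists when \<open>Q\<close> is nonzero and \<open>P\<close> is not a unit; the norm is only used in
  this situation. The library's \<open>multiplicity\<close> is not available for polynomials over an arbitrary
  type of class \<open>field\<close>.
\<close>

definition padic_norm :: "'k::field poly \<Rightarrow> 'k poly \<Rightarrow> real" where
  "padic_norm P Q = 2 powi (- int ((GREATEST \<nu>. P ^ \<nu> dvd Q) * degree P))"

definition littlewood_inf :: "'k::field poly \<Rightarrow> 'k fls \<Rightarrow> real" where
  "littlewood_inf P \<Gamma> =
     (INF Q \<in> {Q. Q \<noteq> 0}. laurent_norm (laurent_of_poly Q) * padic_norm P Q
        * laurent_norm (laurent_frac (laurent_of_poly Q * \<Gamma>)))"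

definition padic_littlewood_conjecture :: "'k::field poly \<Rightarrow> bool" where
  "padic_littlewood_conjecture P \<longleftrightarrow> (\<forall>\<Gamma> :: 'k fls. littlewood_inf P \<Gamma> = 0)"

definition padic_littlewood_counterexample :: "'k::field poly \<Rightarrow> 'k fls \<Rightarrow> bool" where
  "padic_littlewood_counterexample P \<Gamma> \<longleftrightarrow> littlewood_inf P \<Gamma> > 0"

text \<open>
  The terms of the series \<open>\<Lambda>(P)\<close>, whose \<open>n\<close>-th term involves the power \<open>-n\<close> of \<open>P\<close>, for
  \<open>n \<ge> 1\<close>; the index is shifted by one. The series itself is \<open>\<Lambda>(t)\<close> for \<open>P = [:0, 1:]\<close>.
\<close>

definition paperfolding_term :: "'k::field poly \<Rightarrow> nat \<Rightarrow> 'k fls" where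
  "paperfolding_term P n =
     fls_const (of_int (paperfolding (Suc n))) * inverse (laurent_of_poly P) ^ Suc n"

definition paperfolding_series :: "'k::field poly \<Rightarrow> 'k fls" where
  "paperfolding_series P = (\<Sum>n. paperfolding_term P n)"

end

theory Submission
  imports Defs
begin

text \<open>
  Why the infimum is \<open>2\<^bsup>-4 deg P\<^esup>\<close>. For \<open>P = t\<close> the claim is about Hankel matrices of the paperfolding
  sequence: the factor \<open>|Q|\<^sub>P\<close> pays for a shift of the sequence, and the lower bound says that no
  nonzero polynomial of degree at most \<open>d\<close> annihilates the sequence at \<open>d + 4\<close> consecutive positions
  (\<open>pf_annihilator\<close>).

  An annihilator \<open>R(t) = A(t\<^sup>2) + t B(t\<^sup>2)\<close> splits by the self-similarity of the sequence. With \<open>a = A(-1)\<close>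
  and \<open>b = B(-1)\<close>, on a stretch of half the length \<open>A\<close> maps the sequence to \<open>(-1)\<^sup>m b\<close> and \<open>B\<close> maps it to
  \<open>-(-1)\<^sup>m a\<close>. Since \<open>A\<close> and \<open>B\<close> commute, computing \<open>A B\<close> in both orders gives \<open>a\<^sup>2 + b\<^sup>2 = 0\<close>
  (\<open>crossed_annihilation\<close>). The coefficients of \<open>R\<close> may be taken in the prime field
  (\<open>exists_frob_fixed_annihilator\<close>), where \<open>-1\<close> is not a square, so \<open>a = b = 0\<close>. Hence \<open>A\<close> and \<open>B\<close> are
  annihilators and divisible by \<open>t + 1\<close>.

  This halves the degree but also halves the excess \<open>4\<close> of the length over the degree. The loss is
  made up for by the new factor: nonzero multiples of \<open>t + 1\<close> of degree at most \<open>d\<close> cannot even annihilate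
  \<open>d + 2\<close> consecutive positions (\<open>annihilator_multiple_X_plus_1\<close>), and nonzero multiples of \<open>t\<^sup>2 - 1\<close>
  cannot annihilate \<open>d\<close> of them (\<open>annihilator_multiple_X2_minus_1\<close>). The same splitting proves these
  two bounds. The one for \<open>t\<^sup>2 - 1\<close> reproduces itself with half the degree; the one for \<open>t + 1\<close> leads to
  itself, with half the degree, and to the one for \<open>t\<^sup>2 - 1\<close>.

  For general \<open>P\<close>, every polynomial is a sum of terms \<open>t\<^sup>j S\<^sub>j(P)\<close> with \<open>j < deg P\<close>, and the degrees of
  such terms are distinct modulo \<open>deg P\<close>. Norms and fractional parts can then be read off from
  those for \<open>P = t\<close>. The value is attained at \<open>Q = P (P\<^sup>2 + 1)\<close>.
\<close>

section \<open>Polynomials acting on sequences\<close>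

text \<open>
  The polynomial ring acts on sequences with the variable acting as the shift. The linear forms
  of a Hankel matrix are the values of this action, and products of polynomials act by
  composition, so that any two polynomials commute on a sequence.
\<close>

definition shift_act :: "'a::comm_ring_1 poly \<Rightarrow> (nat \<Rightarrow> 'a) \<Rightarrow> nat \<Rightarrow> 'a" where
  "shift_act R s n = (\<Sum>i\<le>degree R. coeff R i * s (n + i))"

lemma shift_act_eq_sum:
  assumes "degree R \<le> N"
  shows "shift_act R s n = (\<Sum>i\<le>N. coeff R i * s (n + i))"
  unfolding shift_act_def using assms
  by (intro sum.mono_neutral_left) (auto simp: coeff_eq_0)

lemma shift_act_0 [simp]: "shift_act 0 s n = 0"
  by (simp add: shift_act_def)

lemma shift_act_pCons [simp]: "shift_act (pCons a R) s n = a * s n + shift_act R s (Suc n)"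
proof -
  have "degree (pCons a R) \<le> Suc (degree R)"
    by (rule degree_pCons_le)
  then show ?thesis
    by (simp add: shift_act_eq_sum[where N = "Suc (degree R)"] shift_act_def
        sum.atMost_Suc_shift del: sum.atMost_Suc)
qed

lemma shift_act_add: "shift_act (P + Q) s n = shift_act P s n + shift_act Q s n"
proof -
  define N where "N = max (degree P) (degree Q)"
  have "degree P \<le> N" "degree Q \<le> N" "degree (P + Q) \<le> N"
    by (auto simp: N_def degree_add_le)
  then show ?thesis
    by (simp add: shift_act_eq_sum[where N = N] distrib_right sum.distrib)
qed

lemma shift_act_smult: "shift_act (smult c P) s n = c * shift_act P s n"
proof -
  have "degree (smult c P) \<le> degree P"
    by (rule degree_smult_le)
  then show ?thesis
    by (simp add: shift_act_eq_sum[where N = "degree P"] sum_distrib_left mult.assoc)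
qed

lemma shift_act_diff: "shift_act (P - Q) s n = shift_act P s n - shift_act Q s n"
  using shift_act_add[of P "smult (-1) Q" s n] shift_act_smult[of "-1" Q s n] by simp

lemma shift_act_mult: "shift_act (P * Q) s n = shift_act P (shift_act Q s) n"
  by (induction P arbitrary: n) (simp_all add: shift_act_add shift_act_smult)

text \<open>
  The value at \<open>n\<close> only sees the terms \<open>n, \<dots>, n + deg R\<close>; the arguments below count how long a
  stretch of known values has to be.
\<close>

lemma shift_act_cong:
  assumes "degree R \<le> N" and "\<And>i. i \<le> N \<Longrightarrow> s (n + i) = s' (n + i)"
  shows "shift_act R s n = shift_act R s' n"
  using assms by (simp add: shift_act_eq_sum)

text \<open>
  The alternating sequence is an eigenvector of the shift for the eigenvalue \<open>-1\<close>.
\<close>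

lemma shift_act_alternating: "shift_act R (\<lambda>n. (- 1) ^ n * c) n = (- 1) ^ n * c * poly R (- 1)"
  by (induction R arbitrary: n) (simp_all add: algebra_simps)

section \<open>Even and odd parts\<close>

text \<open>
  The parts \<open>A\<close>, \<open>B\<close> of \<open>R\<close> are the polynomials with \<open>R(t) = A(t\<^sup>2) + t B(t\<^sup>2)\<close>.
\<close>

definition even_part :: "'a::zero poly \<Rightarrow> 'a poly" where
  "even_part R = Poly (map (\<lambda>i. coeff R (2 * i)) [0..<Suc (degree R)])"

definition odd_part :: "'a::zero poly \<Rightarrow> 'a poly" where
  "odd_part R = Poly (map (\<lambda>i. coeff R (Suc (2 * i))) [0..<Suc (degree R)])"

lemma coeff_even_part [simp]: "coeff (even_part R) i = coeff R (2 * i)"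
  by (auto simp: even_part_def nth_default_def coeff_eq_0 simp del: upt_Suc)

lemma coeff_odd_part [simp]: "coeff (odd_part R) i = coeff R (Suc (2 * i))"
  by (auto simp: odd_part_def nth_default_def coeff_eq_0 simp del: upt_Suc)

lemma even_part_pCons [simp]: "even_part (pCons a R) = pCons a (odd_part R)"
  by (rule poly_eqI) (auto simp: coeff_pCons split: nat.splits)

lemma odd_part_pCons [simp]: "odd_part (pCons a R) = even_part R"
  by (rule poly_eqI) (auto simp: coeff_pCons split: nat.splits)

lemma parts_0 [simp]: "even_part 0 = 0" "odd_part 0 = 0"
  by (auto intro!: poly_eqI)

lemma parts_add:
  "even_part (P + Q) = even_part P + even_part Q" "odd_part (P + Q) = odd_part P + odd_part Q"
  by (auto intro!: poly_eqI)

lemma parts_diff: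
  fixes P Q :: "'a::ab_group_add poly"
  shows "even_part (P - Q) = even_part P - even_part Q" "odd_part (P - Q) = odd_part P - odd_part Q"
  by (auto intro!: poly_eqI)

lemma parts_eq_0D:
  assumes "even_part R = 0" and "odd_part R = 0"
  shows "R = 0"
proof (rule poly_eqI)
  fix n
  have "coeff (even_part R) (n div 2) = 0" "coeff (odd_part R) (n div 2) = 0"
    by (simp_all add: assms)
  then show "coeff R n = coeff 0 n"
    by (cases "even n") (auto elim!: evenE oddE)
qed

lemma degree_parts_le:
  assumes "degree R \<le> 2 * e + 1"
  shows "degree (even_part R) \<le> e" and "degree (odd_part R) \<le> e"
  using assms by (auto intro!: degree_le simp: coeff_eq_0)

section \<open>The paperfolding sequence under the action\<close>

abbreviation pf :: "nat \<Rightarrow> 'a::comm_ring_1" where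
  "pf n \<equiv> of_int (paperfolding n)"

lemma pf_even: "pf (2 * m) = ((- 1) ^ m :: 'a::comm_ring_1)"
  by (simp add: paperfolding_even)

lemma pf_odd: "pf (Suc (2 * m)) = (pf m :: 'a::comm_ring_1)"
  using paperfolding_odd[of m] by simp

text \<open>
  The self-similarity of the sequence in terms of the action. The even part meets the alternating
  terms at the even positions and the sequence itself at the odd positions, and for the odd part
  it is the other way round. If \<open>R\<close> annihilates a stretch, then its parts map a stretch of half the
  length to alternating sequences.
\<close>

lemma shift_act_pf:
  fixes R :: "'a::comm_ring_1 poly"
  shows "shift_act R pf (2 * m) =
      (- 1) ^ m * poly (even_part R) (- 1) + shift_act (odd_part R) pf m"
    and "shift_act R pf (Suc (2 * m)) =
      shift_act (even_part R) pf m - (- 1) ^ m * poly (odd_part R) (- 1)"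
proof (induction R arbitrary: m)
  case (pCons a R)
  {
    case 1
    show ?case
      using pCons.IH(2)[of m] unfolding shift_act_pCons pf_even by (simp add: algebra_simps)
  next
    case 2
    have "Suc (Suc (2 * m)) = 2 * Suc m" by simp
    then show ?case
      using pCons.IH(1)[of "Suc m"] unfolding shift_act_pCons pf_odd by (simp add: algebra_simps)
  }
qed simp_all

lemma paperfolding_sq: "paperfolding n * paperfolding n = 1"
proof (induction n rule: less_induct)
  case (less n)
  show ?case
  proof (cases "even n")
    case True
    then show ?thesis by (subst (1 2) paperfolding.simps) (simp flip: power_add)
  next
    case False
    then show ?thesis using less[of "n div 2"]
      by (subst (1 2) paperfolding.simps) (auto elim: oddE)
  qed
qed


section \<open>Coefficients in the prime field\<close>

text \<open>
  The elements of the prime field are described as the fixed points of the Frobenius map, so that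
  no separate type for the prime field is needed.
\<close>

definition frob_fixed :: "'a::comm_ring_1 \<Rightarrow> bool" where
  "frob_fixed x \<longleftrightarrow> x ^ CHAR('a) = x"

lemma frob_fixed_mult: "frob_fixed x \<Longrightarrow> frob_fixed y \<Longrightarrow> frob_fixed (x * y)"
  by (simp add: frob_fixed_def power_mult_distrib)

lemma frob_fixed_sum:
  assumes "prime CHAR('a::comm_ring_1)" and "\<And>i. i \<in> I \<Longrightarrow> frob_fixed (f i :: 'a)"
  shows "frob_fixed (sum f I)"
  using assms by (simp add: frob_fixed_def freshmans_dream_sum)

lemma frob_fixed_minus_1:
  assumes "odd CHAR('a::comm_ring_1)"
  shows "frob_fixed (- 1 :: 'a)"
  using assms by (simp add: frob_fixed_def)

lemma frob_fixed_power: "frob_fixed x \<Longrightarrow> frob_fixed (x ^ n)"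
  by (simp add: frob_fixed_def flip: power_mult) (metis mult.commute power_mult)

lemma frob_fixed_uminus:
  assumes "odd CHAR('a::comm_ring_1)" and "frob_fixed (x :: 'a)"
  shows "frob_fixed (- x)"
  using assms by (simp add: frob_fixed_def)

lemma frob_fixed_add:
  assumes "prime CHAR('a::comm_ring_1)" and "frob_fixed (x :: 'a)" and "frob_fixed y"
  shows "frob_fixed (x + y)"
  using assms by (simp add: frob_fixed_def freshmans_dream)

lemma frob_fixed_poly:
  assumes "prime CHAR('a::comm_ring_1)" and "\<And>i. frob_fixed (coeff R i :: 'a)" and "frob_fixed x"
  shows "frob_fixed (poly R x)"
  unfolding poly_altdef
  by (intro frob_fixed_sum frob_fixed_mult frob_fixed_power assms)

lemma two_neq_0:
  assumes "CHAR('a::comm_ring_1) mod 4 = 3"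
  shows "(2::'a) \<noteq> 0"
proof
  assume "(2::'a) = 0"
  then have "CHAR('a) dvd 2"
    by (metis of_nat_eq_0_iff_char_dvd of_nat_numeral)
  then have "CHAR('a) \<le> 2"
    by (rule dvd_imp_le) simp
  then show False
    using assms by (cases "CHAR('a) = 2") auto
qed

text \<open>
  The hypothesis \<open>\<ell> \<equiv> 3\<close> modulo 4 enters here: \<open>-1\<close> is not a square in the prime field. From
  \<open>a\<^sup>2 = -b\<^sup>2\<close> with \<open>b \<noteq> 0\<close>, raising to the odd power \<open>(\<ell> - 1) / 2\<close> and applying Fermat's theorem gives
  \<open>1 = -1\<close>.
\<close>

lemma frob_fixed_sum_squares:
  fixes a b :: "'k::field"
  assumes "prime CHAR('k)" and "CHAR('k) mod 4 = 3"
    and "frob_fixed a" and "frob_fixed b" and "a\<^sup>2 + b\<^sup>2 = 0"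
  shows "a = 0 \<and> b = 0"
proof -
  define h where "h = CHAR('k) div 2"
  have l: "CHAR('k) = 2 * h + 1" and "odd h"
    using assms(2) unfolding h_def by presburger+
  have fermat: "x ^ (2 * h) = 1" if "frob_fixed x" "x \<noteq> 0" for x :: 'k
    using that unfolding frob_fixed_def l by simp
  have sq: "a\<^sup>2 = - (b\<^sup>2)"
    using assms(5) by (simp add: eq_neg_iff_add_eq_0)
  have "b = 0"
  proof (rule ccontr)
    assume "b \<noteq> 0"
    with sq have "a \<noteq> 0"
      by auto
    have "a ^ (2 * h) = - (b ^ (2 * h))"
      using sq \<open>odd h\<close> by (simp add: power_mult)
    with fermat[OF assms(3) \<open>a \<noteq> 0\<close>] fermat[OF assms(4) \<open>b \<noteq> 0\<close>] have "(1::'k) = - 1"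
      by simp
    with two_neq_0[OF assms(2)] show False
      by (metis add.right_inverse one_add_one)
  qed
  with sq show ?thesis
    by simp
qed

text \<open>
  A monic annihilator of least degree is unique, and raising its coefficients to the power \<open>\<ell>\<close>
  gives another one, since the sequence takes its values in the prime field. Hence it is fixed by
  Frobenius.
\<close>

lemma exists_frob_fixed_annihilator:
  fixes R :: "'k::field poly"
  assumes char: "prime CHAR('k)" and s: "\<And>n. frob_fixed (s n)"
    and "R \<noteq> 0" and "\<And>n. n \<in> I \<Longrightarrow> shift_act R s n = 0"
  obtains R' where "R' \<noteq> 0" and "degree R' \<le> degree R" and "\<And>i. frob_fixed (coeff R' i)"
    and "\<And>n. n \<in> I \<Longrightarrow> shift_act R' s n = 0"
proof -
  let ?A = "\<lambda>R. R \<noteq> 0 \<and> (\<forall>n\<in>I. shift_act R s n = 0)"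
  obtain M where M: "?A M" and min: "\<And>N. ?A N \<Longrightarrow> degree M \<le> degree N"
    using assms(3,4) ex_has_least_nat[of ?A R degree] by blast
  define R' where "R' = smult (inverse (lead_coeff M)) M"
  define q where "q = CHAR('k)"
  have q: "q > 0"
    using char by (simp add: q_def prime_gt_0_nat)
  define F where "F = map_poly (\<lambda>x. x ^ q) R'"
  have cF: "coeff F i = coeff R' i ^ q" for i
    using q by (simp add: F_def coeff_map_poly)
  have R': "?A R'" "degree R' = degree M" "lead_coeff R' = 1"
    using M by (auto simp: R'_def shift_act_smult)
  have degF: "degree F \<le> degree R'"
    using q by (auto intro!: degree_le simp: cF coeff_eq_0)
  \<comment> \<open>both are monic of the least degree, so a nonzero difference would be a smaller annihilator\<close>
  have "R' - F = 0"
  proof (rule ccontr)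
    assume nz: "R' - F \<noteq> 0"
    have "shift_act F s n = 0" if "n \<in> I" for n
    proof -
      have "shift_act F s n = (\<Sum>i\<le>degree R'. (coeff R' i * s (n + i)) ^ q)"
        using s degF by (simp add: shift_act_eq_sum[where N = "degree R'"] cF power_mult_distrib
            frob_fixed_def q_def)
      also have "\<dots> = shift_act R' s n ^ q"
        using char by (simp add: shift_act_def freshmans_dream_sum q_def)
      finally show ?thesis
        using R'(1) that q by simp
    qed
    with nz R'(1) have "degree M \<le> degree (R' - F)"
      by (intro min) (auto simp: shift_act_diff)
    moreover have "degree (R' - F) < degree M"
    proof -
      have "coeff (R' - F) (degree M) = 0"
        using R'(2,3) by (simp add: cF)
      moreover have "degree (R' - F) \<le> degree M"
        using degF R'(2) by (simp add: degree_diff_le)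
      ultimately show ?thesis
        using nz by (metis le_neq_implies_less leading_coeff_0_iff)
    qed
    ultimately show False
      by simp
  qed
  then have "frob_fixed (coeff R' i)" for i
    using cF[of i] by (simp add: frob_fixed_def q_def)
  with R' min[of R] assms(3,4) show ?thesis
    by (intro that[of R']) auto
qed

section \<open>Bounds on the length of annihilated stretches\<close>

text \<open>
  The even and odd parts cover stretches of the same length and the same starting point when the
  given stretch starts at an even position. From an odd position one either steps back by one,
  replacing \<open>R\<close> by \<open>t R\<close>, or drops the first value. For even \<open>d\<close> the former raises the degree bound to the
  odd number \<open>d + 1\<close>; for odd \<open>d\<close> the latter shortens the stretch by one.
\<close>

lemma even_start:
  fixes R :: "'a::comm_ring_1 poly"
  assumes "R \<noteq> 0" and "degree R \<le> d" and "\<And>i. i < d + k \<Longrightarrow> shift_act R s (n + i) = 0"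
  obtains R' p where "R' \<noteq> 0" and "degree R' \<le> 2 * (d div 2) + 1"
    and "\<And>i. i < 2 * (d div 2) + k \<Longrightarrow> shift_act R' s (2 * p + i) = 0"
proof (cases "even n")
  case True
  then obtain p where "n = 2 * p" by (elim evenE)
  with assms show ?thesis
    by (intro that[of R p]) auto
next
  case False
  then obtain p where n: "n = 2 * p + 1" by (elim oddE)
  show ?thesis
  proof (cases "even d")
    case True
    with assms n show ?thesis
      by (intro that[of "pCons 0 R" p]) (auto simp: degree_pCons_eq)
  next
    case False
    have "shift_act R s (2 * (p + 1) + i) = 0" if "i < 2 * (d div 2) + k" for i
      using assms(3)[of "Suc i"] that False n by (auto elim!: oddE)
    with assms False show ?thesis
      by (intro that[of R "p + 1"]) (auto elim!: oddE)
  qed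
qed

text \<open>
  Applying \<open>B\<close> to \<open>A s\<close>, an alternating sequence of size \<open>c B(-1)\<close>, multiplies it by \<open>B(-1)\<close>; applying
  \<open>A\<close> to \<open>B s\<close>, one of size \<open>-c A(-1)\<close>, multiplies it by \<open>A(-1)\<close>. As \<open>A\<close> and \<open>B\<close> commute,
  \<open>c B(-1)\<^sup>2 = -c A(-1)\<^sup>2\<close>. One position \<open>p\<close> suffices for the comparison, so the values of \<open>A s\<close> are only
  needed on a stretch as long as the degree of \<open>B\<close> requires, and vice versa.
\<close>

lemma crossed_annihilation:
  fixes A B :: "'a::comm_ring_1 poly"
  assumes "degree A \<le> y" and "degree B \<le> x"
    and A: "\<And>i. i \<le> x \<Longrightarrow> shift_act A s (p + i) = (- 1) ^ (p + i) * (c * poly B (- 1))"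
    and B: "\<And>i. i \<le> y \<Longrightarrow> shift_act B s (p + i) = - ((- 1) ^ (p + i) * (c * poly A (- 1)))"
  shows "c * ((poly A (- 1))\<^sup>2 + (poly B (- 1))\<^sup>2) = 0"
proof -
  have "shift_act (B * A) s p = shift_act B (\<lambda>n. (- 1) ^ n * (c * poly B (- 1))) p"
    unfolding shift_act_mult by (rule shift_act_cong[OF assms(2)]) (simp add: A)
  moreover have "shift_act (A * B) s p = shift_act A (\<lambda>n. (- 1) ^ n * (- (c * poly A (- 1)))) p"
    unfolding shift_act_mult by (rule shift_act_cong[OF assms(1)]) (simp add: B)
  ultimately have "(- 1) ^ p * (c * poly B (- 1)) * poly B (- 1) =
      (- 1) ^ p * (- (c * poly A (- 1))) * poly A (- 1)"
    unfolding shift_act_alternating by (simp add: mult.commute)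
  \<comment> \<open>the sign \<open>(-1)\<^sup>p\<close> is its own inverse, so that a second factor cancels it\<close>
  then have "(- 1) ^ p * ((- 1) ^ p * (c * ((poly A (- 1))\<^sup>2 + (poly B (- 1))\<^sup>2))) = 0"
    by (simp add: algebra_simps power2_eq_square)
  then show ?thesis
    by (simp flip: mult.assoc power_mult_distrib)
qed

lemma frob_fixed_pf: "odd CHAR('a::comm_ring_1) \<Longrightarrow> frob_fixed (pf n :: 'a)"
proof -
  assume "odd CHAR('a)"
  have "paperfolding n = 1 \<or> paperfolding n = - 1"
    using paperfolding_sq[of n] by (simp add: square_eq_1_iff)
  with \<open>odd CHAR('a)\<close> show ?thesis
    by (auto simp: frob_fixed_def)
qed

lemma frob_fixed_shift_act:
  assumes "prime CHAR('a::comm_ring_1)" and "\<And>i. frob_fixed (coeff R i :: 'a)" 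
    and "\<And>n. frob_fixed (s n)"
  shows "frob_fixed (shift_act R s n)"
  unfolding shift_act_def by (intro frob_fixed_sum frob_fixed_mult assms)

lemma exists_normalized_annihilator:
  fixes R :: "'k::field poly"
  assumes "prime CHAR('k)" and "\<And>m. frob_fixed (s m)"
    and "R \<noteq> 0" and "degree R \<le> d" and "\<And>i. i < d + k \<Longrightarrow> shift_act R s (n + i) = 0"
  obtains T p where "T \<noteq> 0" and "degree T \<le> 2 * (d div 2) + 1"
    and "\<And>i. frob_fixed (coeff T i)"
    and "\<And>i. i < 2 * (d div 2) + k \<Longrightarrow> shift_act T s (2 * p + i) = 0"
proof -
  obtain R' p where R': "R' \<noteq> 0" "degree R' \<le> 2 * (d div 2) + 1"
      "\<And>i. i < 2 * (d div 2) + k \<Longrightarrow> shift_act R' s (2 * p + i) = 0"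
    using even_start[OF assms(3-5)] by blast
  obtain T where T: "T \<noteq> 0" "degree T \<le> degree R'" "\<And>i. frob_fixed (coeff T i)"
      "\<And>m. m \<in> (\<lambda>i. 2 * p + i) ` {..<2 * (d div 2) + k} \<Longrightarrow> shift_act T s m = 0"
    using exists_frob_fixed_annihilator[where R = R' and s = s
        and I = "(\<lambda>i. 2 * p + i) ` {..<2 * (d div 2) + k}"] assms(1,2) R'(1,3) by blast
  from T R'(2) show ?thesis
    by (intro that[of T p]) auto
qed

lemma parts_mult_X_plus_1:
  fixes R :: "'a::comm_ring_1 poly"
  shows "even_part ([:1, 1:] * R) = even_part R + pCons 0 (odd_part R)"
    and "odd_part ([:1, 1:] * R) = even_part R + odd_part R"
  by (simp_all add: parts_add)

lemma parts_mult_X2_minus_1: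
  fixes R :: "'a::comm_ring_1 poly"
  shows "even_part ([:- 1, 0, 1:] * R) = [:- 1, 1:] * even_part R"
    and "odd_part ([:- 1, 0, 1:] * R) = [:- 1, 1:] * odd_part R"
proof -
  have eq: "[:- 1, 0, 1:] * R = pCons 0 (pCons 0 R) - R"
    by simp
  show "even_part ([:- 1, 0, 1:] * R) = [:- 1, 1:] * even_part R"
    "odd_part ([:- 1, 0, 1:] * R) = [:- 1, 1:] * odd_part R"
    unfolding eq parts_diff by simp_all
qed

text \<open>
  With \<open>e = 0\<close> the conclusion forces \<open>R' = 0\<close>, which is how the descents below end.
\<close>

lemma X_plus_1_factor:
  fixes R :: "'a::idom poly"
  assumes "poly R (- 1) = 0"
  obtains R' where "R = [:1, 1:] * R'" and "degree R \<le> e \<Longrightarrow> R' = 0 \<or> degree R' < e"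
proof -
  have "[:- (- 1), 1:] dvd R"
    using assms by (simp only: poly_eq_0_iff_dvd)
  then obtain R' where R': "R = [:1, 1:] * R'"
    by (auto elim: dvdE)
  have "degree R = Suc (degree R')" if "R' \<noteq> 0"
    unfolding R' using that by (subst degree_mult_eq) auto
  then have "R' = 0 \<or> degree R' < e" if "degree R \<le> e"
    using that by (cases "R' = 0") simp_all
  with R' show ?thesis
    by (rule that)
qed

text \<open>
  Let \<open>V\<close>, \<open>W\<close> be the even and odd parts of \<open>U\<close>, which may be taken over the prime field. The parts of \<open>(t\<^sup>2 - 1) U\<close> are \<open>(t - 1) V\<close> and \<open>(t - 1) W\<close>.
  On the difference sequence \<open>\<delta>\<close> of the paperfolding sequence, \<open>V\<close> and \<open>W\<close> satisfy the crossed
  relations, so \<open>V(-1)\<^sup>2 + W(-1)\<^sup>2 = 0\<close> and both values vanish. Then \<open>V\<close> and \<open>W\<close> annihilate \<open>\<delta>\<close> and are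
  divisible by \<open>t + 1\<close>; as \<open>(t - 1)(t + 1) = t\<^sup>2 - 1\<close>, the quotients satisfy the same hypotheses with
  half the degree, and the descent ends with \<open>V = W = 0\<close>.
\<close>

lemma annihilator_multiple_X2_minus_1:
  fixes U :: "'k::field poly"
  assumes char: "prime CHAR('k)" "CHAR('k) mod 4 = 3"
    and "degree U \<le> d"
    and "\<And>i. i < d + 2 \<Longrightarrow> shift_act ([:- 1, 0, 1:] * U) pf (n + i) = 0"
  shows "U = 0"
  using assms(3,4)
proof (induction d arbitrary: U n rule: less_induct)
  case (less d)
  let ?\<delta> = "shift_act [:- 1, 1:] (pf :: nat \<Rightarrow> 'k)"
  let ?\<mu> = "shift_act [:- 1, 0, 1:] (pf :: nat \<Rightarrow> 'k)"
  have act_\<mu>: "shift_act R ?\<mu> m = shift_act ([:- 1, 0, 1:] * R) pf m" for R m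
    by (simp only: shift_act_mult [symmetric] mult.commute)
  have act_\<delta>: "shift_act R ?\<delta> m = shift_act ([:- 1, 1:] * R) pf m" for R m
    by (simp only: shift_act_mult [symmetric] mult.commute)
  define e where "e = d div 2"
  have odd_char: "odd CHAR('k)"
    using char(2) by presburger
  have fixed_\<mu>: "frob_fixed (?\<mu> m)" for m
    by (rule frob_fixed_shift_act[OF char(1)])
      (auto simp: coeff_pCons odd_char frob_fixed_pf frob_fixed_minus_1 split: nat.splits,
       auto simp: frob_fixed_def prime_gt_0_nat[OF char(1)])
  show ?case
  proof (rule ccontr)
    assume "U \<noteq> 0"
    obtain T p where T: "T \<noteq> 0" "degree T \<le> 2 * e + 1" "\<And>i. frob_fixed (coeff T i)"
        "\<And>i. i < 2 * e + 2 \<Longrightarrow> shift_act T ?\<mu> (2 * p + i) = 0"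
      using exists_normalized_annihilator[where s = "?\<mu>" and k = 2, OF char(1) fixed_\<mu> \<open>U \<noteq> 0\<close>]
        less.prems unfolding act_\<mu> e_def by blast
    define V where "V = even_part T"
    define W where "W = odd_part T"
    have deg: "degree V \<le> e" "degree W \<le> e"
      using degree_parts_le[of T e] T(2) by (auto simp: V_def W_def)
    note parts = parts_mult_X2_minus_1[of T, folded V_def W_def]
    have V: "shift_act V ?\<delta> (p + i) = (- 1) ^ (p + i) * (- 2 * poly W (- 1))" if "i \<le> e" for i
    proof -
      have "shift_act ([:- 1, 0, 1:] * T) pf (Suc (2 * (p + i))) = 0"
        using T(4)[of "2 * i + 1"] that unfolding act_\<mu> by (simp add: algebra_simps)
      moreover have "poly ([:- 1, 1:] * W) (- 1) = - 2 * poly W (- 1)"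
        by simp
      ultimately show ?thesis
        unfolding shift_act_pf(2) parts act_\<delta> by (simp only: right_minus_eq)
    qed
    have W: "shift_act W ?\<delta> (p + i) = - ((- 1) ^ (p + i) * (- 2 * poly V (- 1)))" if "i \<le> e" for i
    proof -
      have "shift_act ([:- 1, 0, 1:] * T) pf (2 * (p + i)) = 0"
        using T(4)[of "2 * i"] that unfolding act_\<mu> by (simp add: algebra_simps)
      moreover have "poly ([:- 1, 1:] * V) (- 1) = - 2 * poly V (- 1)"
        by simp
      ultimately show ?thesis
        unfolding shift_act_pf(1) parts act_\<delta> by (simp only: eq_neg_iff_add_eq_0 add.commute)
    qed
    have "- 2 * ((poly V (- 1))\<^sup>2 + (poly W (- 1))\<^sup>2) = 0"
      by (rule crossed_annihilation[OF deg V W])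
    then have "(poly V (- 1))\<^sup>2 + (poly W (- 1))\<^sup>2 = 0"
      using two_neq_0[OF char(2)] by (simp only: mult_eq_0_iff neg_equal_0_iff_equal) simp
    moreover have "frob_fixed (poly V (- 1))" "frob_fixed (poly W (- 1))"
      using T(3) by (auto intro!: frob_fixed_poly char frob_fixed_minus_1 odd_char simp: V_def W_def)
    ultimately have vw: "poly V (- 1) = 0" "poly W (- 1) = 0"
      using frob_fixed_sum_squares[OF char] by blast+
    have zero: "X = 0" if X: "poly X (- 1) = 0" "degree X \<le> e"
        "\<And>i. i \<le> e \<Longrightarrow> shift_act X ?\<delta> (p + i) = 0" for X
    proof -
      from X_plus_1_factor[OF X(1), of e] X(2)
      obtain X' where X': "X = [:1, 1:] * X'" "X' = 0 \<or> degree X' < e"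
        by blast
      have "shift_act ([:- 1, 0, 1:] * X') pf (p + i) = 0" if "i \<le> e" for i
      proof -
        have "[:- 1, 0, 1:] * X' = [:- 1, 1:] * X"
          unfolding X' by (simp add: mult.assoc [symmetric])
        then show ?thesis
          using X(3)[OF that] unfolding act_\<delta> by simp
      qed
      then have "X' = 0" if "e > 0"
        using less.IH[of "e - 1" X' p] that X'(2) by (auto simp: e_def)
      with X' show ?thesis
        by auto
    qed
    have "V = 0" "W = 0"
      using zero[of V] zero[of W] V W vw deg by auto
    with T(1) show False
      using parts_eq_0D[of T] by (simp add: V_def W_def)
  qed
qed

text \<open>
  Let \<open>A\<close>, \<open>B\<close> be the parts of \<open>U\<close>, again over the prime field. The parts of \<open>(t + 1) U\<close> are \<open>A + t B\<close> and \<open>A + B\<close>, and the crossed relations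
  give \<open>A(-1) = B(-1) = 0\<close>. The polynomial \<open>A + B\<close> then annihilates the sequence and is divisible by
  \<open>t + 1\<close>, so the induction hypothesis yields \<open>B = -A\<close>. What remains is \<open>A + t B = (1 - t) A\<close>, a multiple
  of \<open>t\<^sup>2 - 1\<close>, and the preceding lemma gives \<open>A = 0\<close>.
\<close>

lemma annihilator_multiple_X_plus_1:
  fixes U :: "'k::field poly"
  assumes char: "prime CHAR('k)" "CHAR('k) mod 4 = 3"
    and "degree U \<le> d"
    and "\<And>i. i < d + 3 \<Longrightarrow> shift_act ([:1, 1:] * U) pf (n + i) = 0"
  shows "U = 0"
  using assms(3,4)
proof (induction d arbitrary: U n rule: less_induct)
  case (less d)
  let ?\<sigma> = "shift_act [:1, 1:] (pf :: nat \<Rightarrow> 'k)"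
  have act_\<sigma>: "shift_act R ?\<sigma> m = shift_act ([:1, 1:] * R) pf m" for R m
    by (simp only: shift_act_mult [symmetric] mult.commute)
  define e where "e = d div 2"
  have odd_char: "odd CHAR('k)"
    using char(2) by presburger
  have fixed_\<sigma>: "frob_fixed (?\<sigma> m)" for m
    by (rule frob_fixed_shift_act[OF char(1)])
      (auto simp: coeff_pCons odd_char frob_fixed_pf split: nat.splits,
       auto simp: frob_fixed_def prime_gt_0_nat[OF char(1)])
  show ?case
  proof (rule ccontr)
    assume "U \<noteq> 0"
    obtain T p where T: "T \<noteq> 0" "degree T \<le> 2 * e + 1" "\<And>i. frob_fixed (coeff T i)"
        "\<And>i. i < 2 * e + 3 \<Longrightarrow> shift_act T ?\<sigma> (2 * p + i) = 0"
      using exists_normalized_annihilator[where s = "?\<sigma>" and k = 3, OF char(1) fixed_\<sigma> \<open>U \<noteq> 0\<close>]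
        less.prems unfolding act_\<sigma> e_def by blast
    define A where "A = even_part T"
    define B where "B = odd_part T"
    have deg: "degree A \<le> e" "degree B \<le> e"
      using degree_parts_le[of T e] T(2) by (auto simp: A_def B_def)
    have deg': "degree (A + pCons 0 B) \<le> e + 1" "degree (A + B) \<le> e"
      using deg degree_pCons_le[of 0 B] by (auto intro!: degree_add_le)
    note parts = parts_mult_X_plus_1[of T, folded A_def B_def]
    have AB: "shift_act (A + pCons 0 B) pf (p + i) = (- 1) ^ (p + i) * (1 * poly (A + B) (- 1))"
      if "i \<le> e" for i
    proof -
      have "shift_act ([:1, 1:] * T) pf (Suc (2 * (p + i))) = 0"
        using T(4)[of "2 * i + 1"] that unfolding act_\<sigma> by (simp add: algebra_simps)
      then show ?thesis
        unfolding shift_act_pf(2) parts by simp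
    qed
    \<comment> \<open>the stretch has odd length, and one more even than odd position, which matches the larger degree of the other part\<close>
    have BA: "shift_act (A + B) pf (p + i) = - ((- 1) ^ (p + i) * (1 * poly (A + pCons 0 B) (- 1)))"
      if "i \<le> e + 1" for i
    proof -
      have "shift_act ([:1, 1:] * T) pf (2 * (p + i)) = 0"
        using T(4)[of "2 * i"] that unfolding act_\<sigma> by (simp add: algebra_simps)
      then show ?thesis
        unfolding shift_act_pf(1) parts by (simp add: eq_neg_iff_add_eq_0 add.commute)
    qed
    have "1 * ((poly (A + pCons 0 B) (- 1))\<^sup>2 + (poly (A + B) (- 1))\<^sup>2) = 0"
      by (rule crossed_annihilation[OF deg' AB BA])
    moreover have "frob_fixed (poly A (- 1))" "frob_fixed (poly B (- 1))"
      using T(3) by (auto intro!: frob_fixed_poly char frob_fixed_minus_1 odd_char simp: A_def B_def)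
    moreover from this have "frob_fixed (poly (A + pCons 0 B) (- 1))" "frob_fixed (poly (A + B) (- 1))"
      using frob_fixed_add[OF char(1)] frob_fixed_uminus[OF odd_char, of "poly B (- 1)"]
      by (simp_all add: frob_fixed_add[OF char(1), of _ "- _", simplified])
    ultimately have "poly (A + pCons 0 B) (- 1) = 0" and plus: "poly (A + B) (- 1) = 0"
      using frob_fixed_sum_squares[OF char] by (metis mult_1)+
    \<comment> \<open>the two values are \<open>A(-1) - B(-1)\<close> and \<open>A(-1) + B(-1)\<close>\<close>
    then have "poly A (- 1) = poly B (- 1)" "2 * poly A (- 1) = 0"
      by simp_all
    then have a: "poly A (- 1) = 0"
      using two_neq_0[OF char(2)] by simp
    have "A + B = 0"
    proof -
      from X_plus_1_factor[OF plus, of e] deg'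
      obtain X where X: "A + B = [:1, 1:] * X" "X = 0 \<or> degree X < e"
        by blast
      have "shift_act ([:1, 1:] * X) pf (p + i) = 0" if "i \<le> e + 1" for i
        using BA[OF that] \<open>poly (A + pCons 0 B) (- 1) = 0\<close> unfolding X(1) by simp
      then have "X = 0" if "e > 0"
        using less.IH[of "e - 1" X p] that X(2) by (auto simp: e_def)
      with X show ?thesis
        by auto
    qed
    then have B: "B = - A"
      by (simp add: eq_neg_iff_add_eq_0 add.commute)
    have "A = 0"
    proof -
      from X_plus_1_factor[OF a, of e] deg
      obtain X where X: "A = [:1, 1:] * X" "X = 0 \<or> degree X < e"
        by blast
      have eq: "[:- 1, 0, 1:] * X = - (A + pCons 0 B)"
        unfolding B X by simp
      have "shift_act ([:- 1, 0, 1:] * X) pf (p + i) = 0" if "i \<le> e" for i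
        using AB[OF that] plus unfolding eq using shift_act_smult[of "- 1" "A + pCons 0 B"] by simp
      then have "X = 0" if "e > 0"
        using annihilator_multiple_X2_minus_1[OF char, of X "e - 1" p] that X(2) by auto
      with X show ?thesis
        by auto
    qed
    with B T(1) show False
      using parts_eq_0D[of T] by (simp add: A_def B_def)
  qed
qed

text \<open>
  In the case \<open>P = t\<close> this is the lower bound on the infimum. The parts of \<open>U\<close> satisfy the crossed
  relations, hence vanish at \<open>-1\<close> and annihilate the sequence on a stretch to which the preceding
  lemma applies. The length \<open>d + 4\<close> cannot be replaced by \<open>d + 3\<close>: \<open>t\<^sup>2 + 1\<close> annihilates the five
  positions \<open>2, \<dots>, 6\<close>.
\<close>

theorem pf_annihilator:
  fixes U :: "'k::field poly"
  assumes char: "prime CHAR('k)" "CHAR('k) mod 4 = 3"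
    and "degree U \<le> d"
    and "\<And>i. i < d + 4 \<Longrightarrow> shift_act U pf (n + i) = 0"
  shows "U = 0"
proof (rule ccontr)
  assume "U \<noteq> 0"
  define e where "e = d div 2"
  have odd_char: "odd CHAR('k)"
    using char(2) by presburger
  have fixed_pf: "frob_fixed (pf m :: 'k)" for m
    by (rule frob_fixed_pf[OF odd_char])
  obtain T :: "'k poly" and p where T: "T \<noteq> 0" "degree T \<le> 2 * e + 1" "\<And>i. frob_fixed (coeff T i)"
      "\<And>i. i < 2 * e + 4 \<Longrightarrow> shift_act T pf (2 * p + i) = 0"
    using exists_normalized_annihilator[where s = "pf :: nat \<Rightarrow> 'k" and k = 4,
        OF char(1) fixed_pf \<open>U \<noteq> 0\<close>] assms(3,4)
    unfolding e_def by blast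
  define A where "A = even_part T"
  define B where "B = odd_part T"
  have deg: "degree A \<le> e" "degree B \<le> e"
    using degree_parts_le[of T e] T(2) by (auto simp: A_def B_def)
  then have deg': "degree A \<le> e + 1" "degree B \<le> e + 1"
    by simp_all
  have A: "shift_act A pf (p + i) = (- 1) ^ (p + i) * (1 * poly B (- 1))" if "i \<le> e + 1" for i
    using shift_act_pf(2)[of T "p + i", folded A_def B_def] T(4)[of "2 * i + 1"] that
    by (simp add: algebra_simps)
  have B: "shift_act B pf (p + i) = - ((- 1) ^ (p + i) * (1 * poly A (- 1)))" if "i \<le> e + 1" for i
    using shift_act_pf(1)[of T "p + i", folded A_def B_def] T(4)[of "2 * i"] that
    by (simp add: algebra_simps eq_neg_iff_add_eq_0)
  have "1 * ((poly A (- 1))\<^sup>2 + (poly B (- 1))\<^sup>2) = 0"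
    by (rule crossed_annihilation[OF deg' A B])
  moreover have "frob_fixed (poly A (- 1))" "frob_fixed (poly B (- 1))"
    using T(3) by (auto intro!: frob_fixed_poly char frob_fixed_minus_1 odd_char simp: A_def B_def)
  ultimately have ab: "poly A (- 1) = 0" "poly B (- 1) = 0"
    using frob_fixed_sum_squares[OF char] by (metis mult_1)+
  have zero: "X = 0" if X: "poly X (- 1) = 0" "degree X \<le> e"
      "\<And>i. i \<le> e + 1 \<Longrightarrow> shift_act X pf (p + i) = 0" for X :: "'k poly"
  proof -
    from X_plus_1_factor[OF X(1), of e] X(2)
    obtain X' where X': "X = [:1, 1:] * X'" "X' = 0 \<or> degree X' < e"
      by blast
    have "X' = 0" if "e > 0"
      using annihilator_multiple_X_plus_1[OF char, of X' "e - 1" p] that X'(2) X(3)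
      unfolding X'(1) by auto
    with X' show ?thesis
      by auto
  qed
  have "A = 0" "B = 0"
    using zero[of A] zero[of B] A B ab deg by auto
  with T(1) show False
    using parts_eq_0D[of T] by (simp add: A_def B_def)
qed

section \<open>Polynomials and fractional parts among Laurent series\<close>

unbundle Formal_Power_Series.fps_syntax
unbundle Formal_Laurent_Series.fps_syntax

lemma laurent_of_poly_pCons:
  "laurent_of_poly (pCons a Q) = fls_const a + fls_X_inv * laurent_of_poly Q"
  by (cases "a = 0 \<and> Q = 0") (auto simp: laurent_of_poly_def map_poly_pCons)

lemma laurent_of_poly_0 [simp]: "laurent_of_poly 0 = 0"
  by (simp add: laurent_of_poly_def)

lemma laurent_of_poly_nth:
  "laurent_of_poly Q $$ k = (if k \<le> 0 then coeff Q (nat (- k)) else 0)"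
proof (induction Q arbitrary: k)
  case (pCons a Q)
  have "nat (- k) = Suc (nat (- (k + 1)))" if "k < 0"
    using that by simp
  then show ?case
    using pCons.IH[of "k + 1"]
    by (auto simp: laurent_of_poly_pCons fls_X_inv_times_conv_shift coeff_pCons split: nat.splits)
qed simp

lemma laurent_of_poly_add: "laurent_of_poly (P + Q) = laurent_of_poly P + laurent_of_poly Q"
  by (rule fls_eqI) (simp add: laurent_of_poly_nth)

lemma laurent_of_poly_sum: "laurent_of_poly (sum f I) = (\<Sum>i\<in>I. laurent_of_poly (f i))"
  by (induction I rule: infinite_finite_induct) (simp_all add: laurent_of_poly_add)

lemma laurent_of_poly_smult: "laurent_of_poly (smult c P) = fls_const c * laurent_of_poly P"
  by (rule fls_eqI) (simp add: laurent_of_poly_nth)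

lemma laurent_of_poly_mult: "laurent_of_poly (P * Q) = laurent_of_poly P * laurent_of_poly Q"
  by (induction P)
    (simp_all add: laurent_of_poly_pCons laurent_of_poly_add laurent_of_poly_smult algebra_simps)

lemma laurent_of_poly_eq_0_iff [simp]: "laurent_of_poly P = 0 \<longleftrightarrow> P = 0"
proof
  assume "laurent_of_poly P = 0"
  then have "coeff P n = 0" for n
    using laurent_of_poly_nth[of P "- int n"] by simp
  then show "P = 0"
    by (intro poly_eqI) simp
qed simp

lemma laurent_of_poly_monom_1: "laurent_of_poly (monom 1 n) = fls_X_inv ^ n"
  by (rule fls_eqI) (auto simp: laurent_of_poly_nth)

lemma subdegree_laurent_of_poly: "fls_subdegree (laurent_of_poly P) = - int (degree P)"
proof (cases "P = 0")
  case False
  then show ?thesis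
    by (intro fls_subdegree_eqI) (auto simp: laurent_of_poly_nth coeff_eq_0)
qed simp

lemma laurent_norm_of_poly: "P \<noteq> 0 \<Longrightarrow> laurent_norm (laurent_of_poly P) = 2 powi int (degree P)"
  by (simp add: laurent_norm_def subdegree_laurent_of_poly)

lemma laurent_frac_nth: "laurent_frac \<Gamma> $$ k = (if k \<ge> 1 then \<Gamma> $$ k else 0)"
  by (auto simp: laurent_frac_def)

lemma laurent_frac_eqI:
  assumes "\<And>k. k \<le> 0 \<Longrightarrow> \<Delta> $$ k = 0" and "\<Gamma> = laurent_of_poly G + \<Delta>"
  shows "laurent_frac \<Gamma> = \<Delta>"
  by (rule fls_eqI) (use assms in \<open>auto simp: laurent_frac_nth laurent_of_poly_nth\<close>)

lemma laurent_frac_0 [simp]: "laurent_frac 0 = 0"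
  by (rule fls_eqI) (simp add: laurent_frac_nth)

lemma laurent_integer_plus_frac:
  "\<Gamma> = laurent_of_poly (fls_prpart \<Gamma> + [:\<Gamma> $$ 0:]) + laurent_frac \<Gamma>"
proof (rule fls_eqI)
  fix k :: int
  consider "k < 0" | "k = 0" | "k \<ge> 1"
    by linarith
  then show "\<Gamma> $$ k =
      (laurent_of_poly (fls_prpart \<Gamma> + [:\<Gamma> $$ 0:]) + laurent_frac \<Gamma>) $$ k"
    by cases (auto simp: laurent_frac_nth laurent_of_poly_nth coeff_pCons split: nat.splits)
qed

lemma subdegree_laurent_frac:
  assumes "laurent_frac \<Gamma> \<noteq> 0"
  shows "fls_subdegree (laurent_frac \<Gamma>) \<ge> 1"
  using assms by (intro fls_subdegree_geI) (auto simp: laurent_frac_nth)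

text \<open>
  Multiplication by \<open>t\<close> shifts the coefficients, so the fractional part of a multiple \<open>R \<Gamma>\<close> encodes the
  action of \<open>R\<close> on the coefficient sequence of \<open>\<Gamma>\<close>.
\<close>

lemma laurent_mult_nth_eq_shift_act:
  "(laurent_of_poly R * \<Gamma>) $$ int n = shift_act R (\<lambda>m. \<Gamma> $$ int m) n"
proof (induction R arbitrary: n)
  case (pCons a R)
  have "laurent_of_poly (pCons a R) * \<Gamma> =
      fls_const a * \<Gamma> + fls_shift 1 (laurent_of_poly R * \<Gamma>)"
    by (simp add: laurent_of_poly_pCons distrib_right mult.assoc flip: fls_X_inv_times_conv_shift)
  then show ?case
    using pCons.IH[of "Suc n"] by (simp add: add.commute)
qed simp

section \<open>Substituting a polynomial for the variable\<close>

text \<open>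
  The map \<open>\<Gamma>(t) \<mapsto> \<Gamma>(P(t))\<close>. The formal variable of the series is \<open>1/t\<close>, which is to be replaced by
  \<open>1/P(t)\<close>, a power series in \<open>1/t\<close> without constant term when \<open>P\<close> is not constant.
\<close>

definition subst_poly :: "'k::field poly \<Rightarrow> 'k fls \<Rightarrow> 'k fls" where
  "subst_poly P \<Gamma> = fls_compose_fps \<Gamma> (fls_regpart (inverse (laurent_of_poly P)))"

context
  fixes P :: "'k::field poly"
  assumes deg_P: "degree P > 0"
begin


lemma P_nonzero: "P \<noteq> 0"
  using deg_P by auto

lemma fps_to_fls_inverse_P:
  "fps_to_fls (fls_regpart (inverse (laurent_of_poly P))) = inverse (laurent_of_poly P)"
  using P_nonzero by (simp add: subdegree_laurent_of_poly)

lemma inverse_P_nth_0: "fls_regpart (inverse (laurent_of_poly P)) $ 0 = 0"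
  using P_nonzero deg_P by (simp add: subdegree_laurent_of_poly)

lemma inverse_P_nonzero: "fls_regpart (inverse (laurent_of_poly P)) \<noteq> 0"
  using fps_to_fls_inverse_P P_nonzero by force

lemma subdegree_inverse_P: "subdegree (fls_regpart (inverse (laurent_of_poly P))) = degree P"
proof -
  have "int (subdegree (fls_regpart (inverse (laurent_of_poly P)))) = int (degree P)"
    using fps_to_fls_inverse_P P_nonzero
    by (metis fls_subdegree_fls_to_fps fls_inverse_subdegree subdegree_laurent_of_poly minus_minus)
  then show ?thesis
    by simp
qed

lemma subst_poly_add: "subst_poly P (\<Gamma> + \<Delta>) = subst_poly P \<Gamma> + subst_poly P \<Delta>"
  by (simp add: subst_poly_def fls_compose_fps_add[OF inverse_P_nonzero inverse_P_nth_0])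

lemma subst_poly_diff: "subst_poly P (\<Gamma> - \<Delta>) = subst_poly P \<Gamma> - subst_poly P \<Delta>"
  by (simp add: subst_poly_def fls_compose_fps_diff[OF inverse_P_nonzero inverse_P_nth_0])

lemma subst_poly_mult: "subst_poly P (\<Gamma> * \<Delta>) = subst_poly P \<Gamma> * subst_poly P \<Delta>"
  by (simp add: subst_poly_def fls_compose_fps_mult[OF inverse_P_nonzero inverse_P_nth_0])

lemma subst_poly_power: "subst_poly P (\<Gamma> ^ n) = subst_poly P \<Gamma> ^ n"
  by (simp add: subst_poly_def fls_compose_fps_power[OF inverse_P_nonzero inverse_P_nth_0])

lemma subst_poly_const [simp]: "subst_poly P (fls_const c) = fls_const c"
  by (simp add: subst_poly_def)

lemma subst_poly_0 [simp]: "subst_poly P 0 = 0"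
  by (simp add: subst_poly_def)

lemma subst_poly_sum: "subst_poly P (sum f I) = (\<Sum>i\<in>I. subst_poly P (f i))"
  by (induction I rule: infinite_finite_induct) (simp_all add: subst_poly_add)

lemma subst_poly_X [simp]: "subst_poly P fls_X = inverse (laurent_of_poly P)"
  by (simp add: subst_poly_def fps_to_fls_inverse_P)

lemma subst_poly_X_inv [simp]: "subst_poly P fls_X_inv = laurent_of_poly P"
  using fls_compose_fps_inverse[OF inverse_P_nonzero inverse_P_nth_0, of fls_X]
  by (simp add: subst_poly_def fls_inverse_X fps_to_fls_inverse_P)

lemma subst_poly_eq_0_iff [simp]: "subst_poly P \<Gamma> = 0 \<longleftrightarrow> \<Gamma> = 0"
  by (simp add: subst_poly_def fls_compose_fps_eq_0_iff[OF inverse_P_nonzero inverse_P_nth_0])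

lemma subdegree_subst_poly: "fls_subdegree (subst_poly P \<Gamma>) = fls_subdegree \<Gamma> * int (degree P)"
  by (simp add: subst_poly_def subdegree_fls_compose_fps[OF inverse_P_nth_0] subdegree_inverse_P)

lemma subst_poly_of_poly: "subst_poly P (laurent_of_poly R) = laurent_of_poly (R \<circ>\<^sub>p P)"
proof (induction R)
  case (pCons a R)
  have "laurent_of_poly [:a:] = fls_const a"
    by (simp add: laurent_of_poly_pCons)
  with pCons show ?case
    by (simp add: pcompose_pCons laurent_of_poly_add laurent_of_poly_mult laurent_of_poly_pCons
        subst_poly_add subst_poly_mult)
qed simp

text \<open>
  The powers \<open>1, t, \<dots>, t\<^bsup>p-1\<^esup>\<close> with \<open>p = deg P\<close> generate \<open>K[t]\<close> over \<open>K[P]\<close>, by repeated division by \<open>P\<close>.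
\<close>

lemma base_P_expansion:
  "\<exists>S. R = (\<Sum>j<degree P. monom 1 j * (S j \<circ>\<^sub>p P))"
proof (induction "degree R" arbitrary: R rule: less_induct)
  case less
  have rem: "R mod P = (\<Sum>j<degree P. monom (coeff (R mod P) j) j)"
  proof (rule poly_eqI)
    fix n
    have "degree (R mod P) < degree P"
      using degree_mod_less[OF P_nonzero, of R] deg_P by auto
    then have "coeff (R mod P) n = 0" if "n \<ge> degree P"
      using that by (intro coeff_eq_0) simp
    then show "coeff (R mod P) n = coeff (\<Sum>j<degree P. monom (coeff (R mod P) j) j) n"
      by (auto simp: coeff_sum not_less)
  qed
  have "\<exists>S. R div P = (\<Sum>j<degree P. monom 1 j * (S j \<circ>\<^sub>p P))"
  proof (cases "degree R < degree P")
    case True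
    then show ?thesis
      by (intro exI[of _ "\<lambda>_. 0"]) (simp add: div_poly_less)
  next
    case False
    have "degree (R mod P) < degree P"
      using degree_mod_less[OF P_nonzero, of R] deg_P by auto
    moreover have "degree (P * (R div P)) = degree P + degree (R div P)" if "R div P \<noteq> 0"
      using that P_nonzero by (rule degree_mult_eq[rotated])
    moreover have "P * (R div P) + R mod P = R"
      by simp
    ultimately have "degree R = degree P + degree (R div P)" if "R div P \<noteq> 0"
      using that by (metis degree_add_eq_left trans_less_add1)
    with False deg_P have "degree (R div P) < degree R"
      by (cases "R div P = 0") auto
    then show ?thesis
      by (rule less)
  qed
  then obtain S where S: "R div P = (\<Sum>j<degree P. monom 1 j * (S j \<circ>\<^sub>p P))"
    by blast
  have "R = R mod P + P * (R div P)"
    by simp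
  also have "\<dots> = (\<Sum>j<degree P. monom 1 j * (pCons (coeff (R mod P) j) (S j) \<circ>\<^sub>p P))"
    unfolding S by (subst rem)
      (simp add: sum_distrib_left sum.distrib pcompose_pCons algebra_simps smult_monom)
  finally show ?case
    by (intro exI[of _ "\<lambda>j. pCons (coeff (R mod P) j) (S j)"])
qed

text \<open>
  The degree in \<open>t\<close> of a nonzero \<open>t\<^sup>j F\<^sub>j(P)\<close> is congruent to \<open>j\<close> modulo \<open>deg P\<close>. Different summands have
  different degrees, so nothing cancels and the sum has the largest of them.
\<close>

lemma subdegree_base_P_sum:
  assumes "i < degree P" and "F i \<noteq> 0"
  defines "T \<equiv> \<Sum>j<degree P. fls_X_inv ^ j * subst_poly P (F j)"
  shows "T \<noteq> 0" and "fls_subdegree T \<le> fls_subdegree (F i) * int (degree P) - int i"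
proof -
  define J where "J = {j. j < degree P \<and> F j \<noteq> 0}"
  define d where "d j = fls_subdegree (F j) * int (degree P) - int j" for j
  have subdeg: "fls_subdegree (fls_X_inv ^ j * subst_poly P (F j)) = d j" if "j \<in> J" for j
    using that by (simp add: J_def d_def subdegree_subst_poly)
  \<comment> \<open>the residue of the degree \<open>-d j\<close> modulo \<open>deg P\<close> recovers \<open>j\<close>\<close>
  have inj: "j = j'" if "d j = d j'" "j \<in> J" "j' \<in> J" for j j'
  proof -
    have "(- d j) mod int (degree P) = int j" if "j \<in> J" for j
    proof -
      have "(- d j) mod int (degree P) = int j mod int (degree P)"
        unfolding d_def by (simp add: mod_eq_dvd_iff)
      with that show ?thesis
        by (simp add: J_def)
    qed
    with that show ?thesis
      by (metis of_nat_eq_iff)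
  qed
  have "finite J" "i \<in> J"
    using assms by (auto simp: J_def)
  define m where "m = arg_min_on d J"
  have m: "m \<in> J" "\<And>j. j \<in> J \<Longrightarrow> d m \<le> d j"
    using \<open>finite J\<close> \<open>i \<in> J\<close> arg_min_if_finite(1)[of J d] arg_min_least[of J _ d]
    by (auto simp: m_def)
  \<comment> \<open>only the summand of largest degree contributes to the coefficient at \<open>d m\<close>\<close>
  have other: "(fls_X_inv ^ j * subst_poly P (F j)) $$ d m = 0" if "j < degree P" "j \<noteq> m" for j
  proof (cases "j \<in> J")
    case True
    then have "d m < d j"
      using m inj that(2) by (metis order_le_imp_less_or_eq)
    then show ?thesis
      using subdeg[OF True] by (intro fls_eq0_below_subdegree) simp
  next
    case False
    with that show ?thesis
      by (simp add: J_def)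
  qed
  have "T $$ d m = (\<Sum>j<degree P. (fls_X_inv ^ j * subst_poly P (F j)) $$ d m)"
    by (simp add: T_def fls_nth_sum)
  also have "\<dots> = (\<Sum>j\<in>{m}. (fls_X_inv ^ j * subst_poly P (F j)) $$ d m)"
    using m(1) other by (intro sum.mono_neutral_right) (auto simp: J_def)
  also have "\<dots> \<noteq> 0"
  proof -
    have "fls_X_inv ^ m * subst_poly P (F m) \<noteq> 0"
      using m(1) by (simp add: J_def)
    then show ?thesis
      using nth_fls_subdegree_nonzero[of "fls_X_inv ^ m * subst_poly P (F m)"] subdeg[OF m(1)] by simp
  qed
  finally have nz: "T $$ d m \<noteq> 0" .
  then show "T \<noteq> 0"
    by auto
  have "fls_subdegree T \<le> d m"
    by (rule fls_subdegree_leI[OF nz])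
  also have "\<dots> \<le> d i"
    by (rule m(2)[OF \<open>i \<in> J\<close>])
  finally show "fls_subdegree T \<le> fls_subdegree (F i) * int (degree P) - int i"
    by (simp add: d_def)
qed

text \<open>
  A nonzero fractional part has degree at most \<open>-1\<close>. Substituting \<open>P\<close> turns this into at most \<open>-deg P\<close>,
  and multiplication by \<open>t\<^sup>j\<close> with \<open>j < deg P\<close> keeps the degree negative.
\<close>

lemma laurent_frac_base_P_sum:
  "laurent_frac (\<Sum>j<degree P. fls_X_inv ^ j * subst_poly P (F j)) =
     (\<Sum>j<degree P. fls_X_inv ^ j * subst_poly P (laurent_frac (F j)))"
proof (rule laurent_frac_eqI)
  define G where "G j = fls_prpart (F j) + [:F j $$ 0:]" for j
  have F: "F j = laurent_of_poly (G j) + laurent_frac (F j)" for j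
    unfolding G_def by (rule laurent_integer_plus_frac)
  have "fls_X_inv ^ j * subst_poly P (F j) = laurent_of_poly (monom 1 j * (G j \<circ>\<^sub>p P)) +
      fls_X_inv ^ j * subst_poly P (laurent_frac (F j))" for j
    by (subst F) (simp add: subst_poly_add subst_poly_of_poly laurent_of_poly_mult
        laurent_of_poly_monom_1 distrib_left)
  then show "(\<Sum>j<degree P. fls_X_inv ^ j * subst_poly P (F j)) =
      laurent_of_poly (\<Sum>j<degree P. monom 1 j * (G j \<circ>\<^sub>p P)) +
      (\<Sum>j<degree P. fls_X_inv ^ j * subst_poly P (laurent_frac (F j)))"
    by (simp add: laurent_of_poly_sum sum.distrib)
  fix k :: int
  assume "k \<le> 0"
  have "(fls_X_inv ^ j * subst_poly P (laurent_frac (F j))) $$ k = 0" if "j < degree P" for j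
  proof (cases "laurent_frac (F j) = 0")
    case False
    have "k < int (degree P) - int j"
      using \<open>k \<le> 0\<close> that by simp
    also have "\<dots> \<le> fls_subdegree (laurent_frac (F j)) * int (degree P) - int j"
      using mult_right_mono[OF subdegree_laurent_frac[OF False], of "int (degree P)"] by simp
    also have "\<dots> = fls_subdegree (fls_X_inv ^ j * subst_poly P (laurent_frac (F j)))"
      using False by (simp add: subdegree_subst_poly)
    finally show ?thesis
      by (rule fls_eq0_below_subdegree)
  qed simp
  then show "(\<Sum>j<degree P. fls_X_inv ^ j * subst_poly P (laurent_frac (F j))) $$ k = 0"
    by (simp add: fls_nth_sum)
qed

lemma laurent_frac_subst_poly: "laurent_frac (subst_poly P \<Gamma>) = subst_poly P (laurent_frac \<Gamma>)"
proof -
  define F where "F j = (if j = 0 then \<Gamma> else 0)" for j :: nat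
  have "(\<Sum>j<degree P. fls_X_inv ^ j * subst_poly P (F j)) = subst_poly P \<Gamma>"
    using deg_P by (subst sum.mono_neutral_right[where S = "{0}"]) (auto simp: F_def)
  moreover have "(\<Sum>j<degree P. fls_X_inv ^ j * subst_poly P (laurent_frac (F j))) =
      subst_poly P (laurent_frac \<Gamma>)"
    using deg_P by (subst sum.mono_neutral_right[where S = "{0}"]) (auto simp: F_def)
  ultimately show ?thesis
    using laurent_frac_base_P_sum[of F] by simp
qed

end

section \<open>The series attached to the paperfolding sequence\<close>

definition pf_series :: "'k::field fls" where
  "pf_series = fps_to_fls (Abs_fps (\<lambda>n. if n = 0 then 0 else pf n))"

lemma pf_series_nth: "pf_series $$ k = (if k \<ge> 1 then pf (nat k) else 0)"
  by (auto simp: pf_series_def)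

lemma pf_series_mult_nth:
  assumes "n \<ge> 1"
  shows "(laurent_of_poly R * pf_series) $$ int n = shift_act R pf n"
  unfolding laurent_mult_nth_eq_shift_act
  by (rule shift_act_cong[OF order_refl]) (use assms in \<open>auto simp: pf_series_nth simp flip: of_nat_add\<close>)

lemma shift_act_monom_mult: "shift_act (monom 1 \<nu> * R) s n = shift_act R s (n + \<nu>)"
  by (induction \<nu> arbitrary: n) (simp_all add: monom_Suc)

text \<open>
  Before the substitution, the remainder after \<open>n\<close> terms has degree less than \<open>-n\<close>, and the
  substitution multiplies degrees by \<open>deg P\<close>.
\<close>

lemma subst_poly_pf_series_sums:
  fixes P :: "'k::field poly"
  assumes "degree P > 0"
  shows "paperfolding_term P sums subst_poly P pf_series"
proof -
  let ?t = "\<lambda>n. fls_const (pf (Suc n)) * fls_X ^ Suc n :: 'k fls"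
  let ?D = "\<lambda>n. (\<Sum>i<n. ?t i) - pf_series"
  have t: "paperfolding_term P n = subst_poly P (?t n)" for n
    by (simp only: paperfolding_term_def subst_poly_mult[OF assms] subst_poly_power[OF assms]
        subst_poly_const[OF assms] subst_poly_X[OF assms])
  have dist: "dist (\<Sum>i<n. paperfolding_term P i) (subst_poly P pf_series) \<le> (1 / 2) ^ n" for n
  proof (cases "?D n = 0")
    case True
    then show ?thesis
      by (simp add: dist_fls_eq_laurent_norm t laurent_norm_def
          flip: subst_poly_sum[OF assms] subst_poly_diff[OF assms])
  next
    case False
    have "?D n $$ k = 0" if "k < int n" for k
    proof -
      have "(\<Sum>i<n. ?t i) $$ k = (\<Sum>i<n. if k = int (Suc i) then pf (Suc i) else 0)"
        unfolding fls_nth_sum by (intro sum.cong refl) (simp del: power_Suc)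
      also have "\<dots> = (\<Sum>i<n. if i = nat k - 1 \<and> k \<ge> 1 then pf (nat k) else 0)"
        by (intro sum.cong refl) (auto simp: nat_add_distrib)
      also have "\<dots> = (if k \<ge> 1 then pf (nat k) else 0)"
        using that by (cases "k \<ge> 1") auto
      finally show ?thesis
        by (simp add: pf_series_nth)
    qed
    then have "int n \<le> fls_subdegree (?D n)"
      using False by (intro fls_subdegree_geI)
    also have "\<dots> \<le> fls_subdegree (?D n) * int (degree P)"
      using assms calculation by (simp add: mult_le_cancel_left1)
    finally have le: "int n \<le> fls_subdegree (subst_poly P (?D n))"
      by (simp only: subdegree_subst_poly[OF assms])
    have "dist (\<Sum>i<n. paperfolding_term P i) (subst_poly P pf_series) =
        laurent_norm (subst_poly P (?D n))"
      by (simp only: dist_fls_eq_laurent_norm t subst_poly_sum[OF assms] subst_poly_diff[OF assms])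
    also have "\<dots> \<le> 2 powi (- int n)"
      using le by (auto simp: laurent_norm_def power_int_increasing)
    also have "\<dots> = (1 / 2) ^ n"
      by (simp add: power_int_minus power_one_over inverse_eq_divide)
    finally show ?thesis .
  qed
  have "(\<lambda>n. dist (\<Sum>i<n. paperfolding_term P i) (subst_poly P pf_series)) \<longlonglongrightarrow> 0"
    by (rule tendsto_sandwich[OF _ _ tendsto_const LIMSEQ_realpow_zero[of "1 / 2"]])
      (use dist in auto)
  then show ?thesis
    unfolding sums_def by (subst tendsto_dist_iff)
qed

text \<open>
  The degree of \<open>Q\<close> bounds the exponents, so the greatest one exists.
\<close>

lemma padic_multiplicity:
  fixes P :: "'k::field poly"
  assumes "degree P > 0" and "Q \<noteq> 0"
  shows "P ^ (GREATEST \<nu>. P ^ \<nu> dvd Q) dvd Q"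
proof (rule GreatestI_nat[where k = 0 and b = "degree Q"])
  fix \<nu> assume "P ^ \<nu> dvd Q"
  then have "degree (P ^ \<nu>) \<le> degree Q"
    using assms(2) by (rule dvd_imp_degree_le)
  moreover have "degree (P ^ \<nu>) = \<nu> * degree P"
    using assms by (intro degree_power_eq) auto
  ultimately show "\<nu> \<le> degree Q"
    using assms(1) by (metis Suc_leI mult_le_mono2 nat_mult_1_right One_nat_def order_trans)
qed simp

text \<open>
  The bound depends only on \<open>R\<close> and not on \<open>\<nu>\<close>: multiplication by \<open>t\<^sup>\<nu>\<close> shifts the sequence, and the
  bound on annihilators is uniform in the starting position.
\<close>

lemma pf_series_frac:
  fixes R :: "'k::field poly" and \<nu> :: nat
  assumes "prime CHAR('k)" and "CHAR('k) mod 4 = 3" and "R \<noteq> 0"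
  defines "f \<equiv> laurent_frac (laurent_of_poly (monom 1 \<nu> * R) * pf_series)"
  shows "f \<noteq> 0" and "fls_subdegree f \<le> int (degree R) + 4"
proof -
  obtain i where i: "i < degree R + 4" "shift_act R pf (\<nu> + 1 + i) \<noteq> 0"
    using pf_annihilator[OF assms(1,2) order_refl, of R "\<nu> + 1"] assms(3) by blast
  have "f $$ int (i + 1) = (laurent_of_poly (monom 1 \<nu> * R) * pf_series) $$ int (i + 1)"
    by (simp add: f_def laurent_frac_nth)
  also have "\<dots> = shift_act R pf (\<nu> + 1 + i)"
    by (subst pf_series_mult_nth) (simp_all add: shift_act_monom_mult add_ac)
  finally have nz: "f $$ int (i + 1) \<noteq> 0"
    using i(2) by simp
  then show "f \<noteq> 0"
    by auto
  show "fls_subdegree f \<le> int (degree R) + 4"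
    using fls_subdegree_leI[OF nz] i(1) by simp
qed

text \<open>
  Write \<open>Q = P\<^sup>\<nu> R\<close> and expand \<open>R\<close> as the sum of the \<open>t\<^sup>j S\<^sub>j(P)\<close>. Fix any \<open>i\<close> with \<open>S\<^sub>i \<noteq> 0\<close>. With \<open>p = deg P\<close>, the degree of
  \<open>Q\<close> is at least \<open>\<nu> p + p deg S\<^sub>i + i\<close>, and the fractional part of \<open>Q\<close> times the series, which is the sum of
  the \<open>t\<^sup>j f\<^sub>j(P)\<close> with \<open>f\<^sub>j\<close> the fractional part belonging to \<open>t\<^sup>\<nu> S\<^sub>j\<close>, has degree at least \<open>i - p (deg S\<^sub>i + 4)\<close>.
  The \<open>P\<close>-adic norm removes \<open>\<nu> p\<close>, and the exponents add up to \<open>2 i - 4 p\<close> or more.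
\<close>

lemma littlewood_product_ge:
  fixes P Q :: "'k::field poly"
  assumes "prime CHAR('k)" and "CHAR('k) mod 4 = 3" and deg: "degree P > 0" and "Q \<noteq> 0"
  shows "2 powi (- 4 * int (degree P)) \<le> laurent_norm (laurent_of_poly Q) * padic_norm P Q *
    laurent_norm (laurent_frac (laurent_of_poly Q * subst_poly P pf_series))"
proof -
  have P: "P \<noteq> 0"
    using deg by auto
  define \<nu> where "\<nu> = (GREATEST \<nu>. P ^ \<nu> dvd Q)"
  obtain R where Q: "Q = P ^ \<nu> * R"
    using padic_multiplicity[OF deg \<open>Q \<noteq> 0\<close>] unfolding \<nu>_def by (elim dvdE)
  obtain S where S: "R = (\<Sum>j<degree P. monom 1 j * (S j \<circ>\<^sub>p P))"
    using base_P_expansion[OF deg, of R] by blast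
  have "R \<noteq> 0"
    using Q \<open>Q \<noteq> 0\<close> by auto
  then obtain i where i: "i < degree P" "S i \<noteq> 0"
    unfolding S by (metis (no_types, lifting) lessThan_iff mult_zero_right pcompose_0 sum.neutral)
  define T where "T = laurent_frac (laurent_of_poly Q * subst_poly P pf_series)"
  define F where "F j = laurent_of_poly (monom 1 \<nu> * S j) * pf_series" for j
  have "laurent_of_poly R = (\<Sum>j<degree P. fls_X_inv ^ j * subst_poly P (laurent_of_poly (S j)))"
    by (subst S) (simp add: laurent_of_poly_sum laurent_of_poly_mult laurent_of_poly_monom_1
        subst_poly_of_poly[OF deg])
  then have "fls_subdegree (laurent_of_poly R) \<le>
      fls_subdegree (laurent_of_poly (S i)) * int (degree P) - int i"
    using subdegree_base_P_sum(2)[OF deg i(1), of "\<lambda>j. laurent_of_poly (S j)"] i(2) by simp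
  then have deg_R: "int (degree R) \<ge> int (degree (S i)) * int (degree P) + int i"
    by (simp add: subdegree_laurent_of_poly)
  have "laurent_of_poly Q * subst_poly P pf_series =
      (\<Sum>j<degree P. fls_X_inv ^ j * subst_poly P (F j))"
  proof -
    have "laurent_of_poly (P ^ \<nu>) = subst_poly P (laurent_of_poly (monom 1 \<nu>))"
      by (simp add: laurent_of_poly_monom_1 subst_poly_power[OF deg] subst_poly_X_inv[OF deg])
        (induction \<nu>, simp_all add: laurent_of_poly_mult one_pCons laurent_of_poly_pCons)
    then show ?thesis
      unfolding Q F_def laurent_of_poly_mult
        \<open>laurent_of_poly R = (\<Sum>j<degree P. fls_X_inv ^ j * subst_poly P (laurent_of_poly (S j)))\<close>
      by (simp add: sum_distrib_left sum_distrib_right subst_poly_mult[OF deg] mult_ac)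
  qed
  then have T: "T = (\<Sum>j<degree P. fls_X_inv ^ j * subst_poly P (laurent_frac (F j)))"
    by (simp add: T_def laurent_frac_base_P_sum[OF deg])
  note frac = pf_series_frac[OF assms(1,2) i(2), of \<nu>, folded F_def]
  have "T \<noteq> 0" and
    "fls_subdegree T \<le> fls_subdegree (laurent_frac (F i)) * int (degree P) - int i"
    using subdegree_base_P_sum[OF deg i(1), of "\<lambda>j. laurent_frac (F j)"] frac(1)
    by (simp_all add: T)
  moreover have "fls_subdegree (laurent_frac (F i)) * int (degree P) \<le>
      (int (degree (S i)) + 4) * int (degree P)"
    by (intro mult_right_mono frac(2)) simp
  ultimately have le: "fls_subdegree T \<le> int (degree (S i)) * int (degree P) + 4 * int (degree P) - int i"
    by (simp add: algebra_simps)
  have deg_Q: "degree Q = \<nu> * degree P + degree R"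
    unfolding Q using \<open>R \<noteq> 0\<close> P by (simp add: degree_mult_eq degree_power_eq)
  have "(2::real) powi (- 4 * int (degree P)) \<le>
      2 powi (int (degree Q) + (- int (\<nu> * degree P)) + (- fls_subdegree T))"
    using le deg_R by (intro power_int_increasing) (simp_all add: deg_Q)
  also have "\<dots> = laurent_norm (laurent_of_poly Q) * padic_norm P Q * laurent_norm T"
    unfolding laurent_norm_of_poly[OF \<open>Q \<noteq> 0\<close>] padic_norm_def \<nu>_def [symmetric]
    using \<open>T \<noteq> 0\<close>
    by (simp add: laurent_norm_def power_int_diff power_int_minus divide_inverse)
  finally show ?thesis
    by (simp add: T_def)
qed

text \<open>
  For \<open>P = t\<close> the polynomial \<open>t\<^sup>2 + 1\<close> annihilates the positions \<open>2, \<dots>, 6\<close> of the sequence, so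
  \<open>t (t\<^sup>2 + 1)\<close> annihilates \<open>1, \<dots>, 5\<close>; its product with the series has a fractional part of degree \<open>-6\<close>.
  The exponents, in units of \<open>deg P\<close>, are \<open>3\<close>, \<open>-1\<close> and \<open>-6\<close>.
\<close>

lemma littlewood_product_attained:
  fixes P :: "'k::field poly"
  assumes two: "(2::'k) \<noteq> 0" and deg: "degree P > 0"
  defines "Q \<equiv> P * (P\<^sup>2 + 1)"
  shows "Q \<noteq> 0" and "laurent_norm (laurent_of_poly Q) * padic_norm P Q *
    laurent_norm (laurent_frac (laurent_of_poly Q * subst_poly P pf_series)) =
      2 powi (- 4 * int (degree P))"
proof -
  let ?C = "[:0, 1, 0, 1:] :: 'k poly"
  have Q: "Q = ?C \<circ>\<^sub>p P"
    by (simp add: Q_def pcompose_pCons power2_eq_square algebra_simps one_pCons)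
  have deg_Q: "degree Q = 3 * degree P"
    unfolding Q by (subst degree_pcompose) simp
  with deg show "Q \<noteq> 0"
    by auto
  have pf: "paperfolding 2 = - 1" "paperfolding 3 = 1" "paperfolding 4 = 1"
      "paperfolding 5 = - 1" "paperfolding 6 = - 1" "paperfolding 7 = 1" "paperfolding 8 = 1"
      "paperfolding 9 = 1"
    by (simp_all add: paperfolding.simps)
  have "(GREATEST \<nu>. P ^ \<nu> dvd Q) = 1"
  proof (rule Greatest_equality)
    show "P ^ 1 dvd Q"
      by (simp add: Q_def)
    fix \<nu> assume \<nu>: "P ^ \<nu> dvd Q"
    show "\<nu> \<le> 1"
    proof (rule ccontr)
      assume "\<not> \<nu> \<le> 1"
      then have "P ^ 2 dvd P ^ \<nu>"
        by (intro le_imp_power_dvd) simp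
      with \<nu> have "P * P dvd P * (P\<^sup>2 + 1)"
        unfolding Q_def power2_eq_square by (rule dvd_trans[rotated])
      then have "P dvd P * P + 1"
        using deg by (auto simp: power2_eq_square)
      then have "P dvd 1"
        by (simp add: dvd_add_right_iff)
      with deg show False
        by (auto dest!: dvd_imp_degree_le)
    qed
  qed
  then have padic: "padic_norm P Q = 2 powi (- int (degree P))"
    by (simp add: padic_norm_def)
  define f where "f = laurent_frac (laurent_of_poly ?C * (pf_series :: 'k fls))"
  have f_nth: "f $$ int n = pf (n + 1) + pf (n + 3)" if "n \<ge> 1" for n
    using that pf_series_mult_nth[OF that, of ?C]
    by (simp add: f_def laurent_frac_nth numeral_3_eq_3)
  have f6: "f $$ 6 \<noteq> 0"
    using f_nth[of 6] two by (simp add: pf)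
  have "fls_subdegree f = 6"
  proof (rule fls_subdegree_eqI[OF f6])
    fix k :: int
    assume "k < 6"
    then consider "k < 1" | "k = 1" | "k = 2" | "k = 3" | "k = 4" | "k = 5"
      by linarith
    then show "f $$ k = 0"
    proof cases
      case 1
      then show ?thesis by (simp add: f_def laurent_frac_nth)
    qed (use f_nth[of 1] f_nth[of 2] f_nth[of 3] f_nth[of 4] f_nth[of 5] in \<open>simp_all add: pf flip: numeral_2_eq_2\<close>)
  qed
  moreover have "laurent_frac (laurent_of_poly Q * subst_poly P pf_series) = subst_poly P f"
    unfolding Q f_def
    by (simp only: subst_poly_of_poly[OF deg, symmetric] subst_poly_mult[OF deg, symmetric]
        laurent_frac_subst_poly[OF deg])
  moreover have "f \<noteq> 0"
    using f6 by auto
  ultimately have frac: "laurent_norm (laurent_frac (laurent_of_poly Q * subst_poly P pf_series)) =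
      2 powi (- (6 * int (degree P)))"
    by (simp add: laurent_norm_def subdegree_subst_poly[OF deg] subst_poly_eq_0_iff[OF deg])
  have add: "(2::real) powi (a + b) = 2 powi a * 2 powi b" for a b
    by (simp add: power_int_add)
  have "laurent_norm (laurent_of_poly Q) * padic_norm P Q *
      laurent_norm (laurent_frac (laurent_of_poly Q * subst_poly P pf_series)) =
      2 powi (3 * int (degree P) + (- int (degree P)) + (- (6 * int (degree P))))"
    unfolding frac padic laurent_norm_of_poly[OF \<open>Q \<noteq> 0\<close>] deg_Q add by simp
  then show "laurent_norm (laurent_of_poly Q) * padic_norm P Q *
      laurent_norm (laurent_frac (laurent_of_poly Q * subst_poly P pf_series)) =
      2 powi (- 4 * int (degree P))"
    by simp
qed

section \<open>The infimum for the substituted series\<close>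

theorem theorem1p1:
  fixes l :: nat and P :: "'k::field poly"
  assumes "prime l" and "l mod 4 = 3"
    and "CHAR('k) = l"
    and "irreducible P"
  shows "\<not> padic_littlewood_conjecture P
    \<and> summable (paperfolding_term P)
    \<and> padic_littlewood_counterexample P (paperfolding_series P)
    \<and> littlewood_inf P (paperfolding_series P) = 2 powi (- 4 * int (degree P))"
proof -
  have char: "prime CHAR('k)" "CHAR('k) mod 4 = 3"
    using assms by simp_all
  have deg: "degree P > 0"
    using assms(4) by (auto simp: irreducible_def is_unit_iff_degree)
  have sums: "paperfolding_term P sums subst_poly P pf_series"
    by (rule subst_poly_pf_series_sums[OF deg])
  then have series: "paperfolding_series P = subst_poly P pf_series"
    by (simp add: paperfolding_series_def sums_iff)
  let ?f = "\<lambda>Q. laurent_norm (laurent_of_poly Q) * padic_norm P Q *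
    laurent_norm (laurent_frac (laurent_of_poly Q * subst_poly P pf_series))"
  note attained = littlewood_product_attained[OF two_neq_0[OF char(2)] deg]
  have "(INF Q \<in> {Q. Q \<noteq> 0}. ?f Q) = 2 powi (- 4 * int (degree P))"
  proof (rule cInf_eq_minimum)
    show "2 powi (- 4 * int (degree P)) \<in> ?f ` {Q. Q \<noteq> 0}"
      using attained by (intro image_eqI[where x = "P * (P\<^sup>2 + 1)"]) simp_all
    show "2 powi (- 4 * int (degree P)) \<le> x" if "x \<in> ?f ` {Q. Q \<noteq> 0}" for x
      using that littlewood_product_ge[OF char deg] by blast
  qed
  then have inf: "littlewood_inf P (paperfolding_series P) = 2 powi (- 4 * int (degree P))"
    by (simp add: littlewood_inf_def series)
  then have pos: "littlewood_inf P (paperfolding_series P) > 0"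
    by simp
  then have "\<not> padic_littlewood_conjecture P"
    unfolding padic_littlewood_conjecture_def by (metis order_less_irrefl)
  with inf pos sums show ?thesis
    by (simp add: padic_littlewood_counterexample_def sums_iff)
qed

end
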